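(* Let $k \ge 1$ and $n \ge 1$ be integers. If $\gcd(2k+1,n)=1$, then the weaving knot $W(2k+1,n)$ has signature $\sigma\bigl(W(2k+1,n)\bigr) = 0$. If $\gcd(2k,n)=1$, then the weaving knot $W(2k,n)$ has signature $\sigma\bigl(W(2k,n)\bigr) = -n+1$.
   Context: For integers $p \ge 2$, $q \ge 1$, $W(p,q)$ denotes the closure of the braid $(\sigma_1\sigma_2^{-1}\sigma_3\cdots\sigma_{p-1}^{\pm1})^q$ on $p$ strands, where the exponents alternate in sign starting with $+1$ for $\sigma_1$; that is, it is obtained from the standard diagram of the torus link $T(p,q)$ (the closure of $(\sigma_1\sigma_2\cdots\sigma_{p-1})^q$) by making it alternating. It has $\gcd(p,q)$ components and is called the weaving knot of type $(p,q)$ when $\gcd(p,q)=1$. Convention: with all strands of the braid oriented in the same direction, each generator $\sigma_i$ is a positive (right-handed) crossing and $\sigma_i^{-1}$ is a negative crossing. The signature $\sigma(L)$ of an oriented link is normalized so that the right-handed trefoil (all crossings positive) has signature $-2$. *)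

theory Defs
  imports "Jordan_Normal_Form.Char_Poly"
begin

section \<open>Braid words and closed braids\<close>

text \<open>
  \<open>Gen i True\<close> is the Artin generator \<open>\<sigma>\<^sub>i\<close> and \<open>Gen i False\<close> its inverse, for \<open>1 \<le> i < p\<close> on
  \<open>p\<close> strands. With all strands oriented in parallel, \<open>\<sigma>\<^sub>i\<close> is a positive (right-handed) crossing
  of strands \<open>i\<close> and \<open>i + 1\<close>.
\<close>

datatype braid_letter = Gen (strand: nat) (positive: bool)

definition letter_sign :: "braid_letter \<Rightarrow> int" where
  "letter_sign g = (if positive g then 1 else -1)"

text \<open>
  \<open>Closure p w\<close> is the oriented link that is the closure of the braid on \<open>p\<close> strands with word \<open>w\<close>.
\<close>

datatype closed_braid = Closure (strands: nat) (braid_word: "braid_letter list")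

definition is_closed_braid :: "closed_braid \<Rightarrow> bool" where
  "is_closed_braid L \<longleftrightarrow> 1 \<le> strands L \<and> (\<forall>g \<in> set (braid_word L). 1 \<le> strand g \<and> strand g < strands L)"

section \<open>Linking numbers\<close>

text \<open>
  A closed oriented rectilinear polygon is given by its cyclic list of vertices in \<open>\<int>\<^sup>2\<close>. Several of
  them form a link diagram by the convention of grid diagrams: at each crossing the vertical segment
  passes over the horizontal one. With over-direction \<open>u\<close> and under-direction \<open>v\<close> the sign of the
  crossing is the sign of \<open>u\<^sub>x v\<^sub>y - u\<^sub>y v\<^sub>x\<close>, which is \<open>+1\<close> for a right-handed crossing.
\<close>

type_synonym point = "int \<times> int"

definition edges :: "point list \<Rightarrow> (point \<times> point) list" where
  "edges P = zip P (rotate1 P)"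

fun over_crossing :: "point \<times> point \<Rightarrow> point \<times> point \<Rightarrow> int" where
  "over_crossing ((x, y\<^sub>1), (x', y\<^sub>2)) ((x\<^sub>1, y), (x\<^sub>2, y')) =
     (if x = x' \<and> y = y' \<and> min x\<^sub>1 x\<^sub>2 < x \<and> x < max x\<^sub>1 x\<^sub>2 \<and> min y\<^sub>1 y\<^sub>2 < y \<and> y < max y\<^sub>1 y\<^sub>2
      then - (sgn (y\<^sub>2 - y\<^sub>1) * sgn (x\<^sub>2 - x\<^sub>1)) else 0)"

definition over_crossings :: "point list \<Rightarrow> point list \<Rightarrow> int" where
  "over_crossings P Q = (\<Sum>e\<leftarrow>edges P. \<Sum>f\<leftarrow>edges Q. over_crossing e f)"

text \<open>Half the sum of the signs of all crossings between the two components.\<close>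

definition linking_number :: "point list \<Rightarrow> point list \<Rightarrow> real" where
  "linking_number P Q = of_int (over_crossings P Q + over_crossings Q P) / 2"

section \<open>The Seifert matrix of a closed braid\<close>

text \<open>
  Seifert's algorithm applied to the closed braid \<open>Closure p w\<close> gives the following surface \<open>F\<close>:
  parallel horizontal discs \<open>D\<^sub>1, \<dots>, D\<^sub>p\<close>, stacked at the heights \<open>1, \<dots>, p\<close> on a vertical axis, and,
  for each letter \<open>w ! j = \<sigma>\<^sub>i\<^sup>\<plusminus>\<close>, a half-twisted vertical band from the rim of \<open>D\<^sub>i\<close> to the rim of
  \<open>D\<close>\<open>\<^sub>i\<^sub>+\<^sub>1\<close> at the angular position \<open>j\<close>. The discs are cooriented upwards, so that their rims run
  counterclockwise. We look at \<open>F\<close> from outside the cylinder containing the rims, cut open before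
  position \<open>0\<close>: the abscissa is the angular position, increasing to the right in the direction of
  the strands, the ordinate is the height, and both are scaled by 4 to keep coordinates integral.

  The group \<open>H\<^sub>1(F)\<close> is free on the loops that belong to the pairs \<open>j < k\<close> of consecutive occurrences
  of the same generator \<open>\<sigma>\<^sub>i\<close>: along \<open>D\<^sub>i\<close> from \<open>j\<close> to \<open>k\<close>, up the band \<open>k\<close>, back along \<open>D\<close>\<open>\<^sub>i\<^sub>+\<^sub>1\<close> to
  \<open>j\<close> and down the band \<open>j\<close>. These loops project to rectangles.
\<close>

definition seifert_basis :: "braid_letter list \<Rightarrow> (nat \<times> nat) list" where
  "seifert_basis w = filter
     (\<lambda>(j, k). j < k \<and> strand (w ! j) = strand (w ! k) \<and>
        (\<forall>l. j < l \<and> l < k \<longrightarrow> strand (w ! l) \<noteq> strand (w ! j)))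
     (List.product [0..<length w] [0..<length w])"

definition rectangle :: "int \<Rightarrow> int \<Rightarrow> int \<Rightarrow> int \<Rightarrow> point list" where
  "rectangle x\<^sub>1 x\<^sub>2 y\<^sub>1 y\<^sub>2 = [(x\<^sub>1, y\<^sub>1), (x\<^sub>2, y\<^sub>1), (x\<^sub>2, y\<^sub>2), (x\<^sub>1, y\<^sub>2)]"

fun seifert_loop :: "braid_letter list \<Rightarrow> nat \<times> nat \<Rightarrow> point list" where
  "seifert_loop w (j, k) =
     (let i = int (strand (w ! j))
      in rectangle (4 * int j) (4 * int k) (4 * i) (4 * i + 4))"

text \<open>
  The positive push-off of a loop. On the discs the positive normal points up. Along a band, going
  up, it points inwards (away from the viewer) at the lower disc and outwards (towards the viewer)
  at the upper disc; in between it turns through the right if the crossing is positive, since then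
  the strand descending from the upper left is the one in front, and through the left if the
  crossing is negative.

  The convention that vertical segments pass over horizontal ones is the correct one for a loop and
  a pushed-off loop: the horizontal segments run inside the discs, hence behind the bands, and the
  pushed-off vertical segment has already come out in front where it passes the height of the upper
  disc.
\<close>

fun seifert_push_off :: "braid_letter list \<Rightarrow> nat \<times> nat \<Rightarrow> point list" where
  "seifert_push_off w (j, k) =
     (let i = int (strand (w ! j))
      in rectangle (4 * int j + letter_sign (w ! j)) (4 * int k + letter_sign (w ! k))
           (4 * i + 1) (4 * i + 5))"

text \<open>
  If some generator does not occur, then \<open>F\<close> is disconnected. Tubing its components together adds
  only zero rows and columns to the symmetrised Seifert matrix, so the signature below is still the
  signature of the link.
\<close>

definition seifert_matrix :: "closed_braid \<Rightarrow> real mat" where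
  "seifert_matrix L =
     (let w = braid_word L; b = seifert_basis w
      in mat (length b) (length b)
           (\<lambda>(r, s). linking_number (seifert_loop w (b ! r)) (seifert_push_off w (b ! s))))"

section \<open>Signature\<close>

text \<open>
  For a real symmetric matrix: the number of positive minus the number of negative eigenvalues,
  counted with multiplicity.
\<close>

definition matrix_signature :: "real mat \<Rightarrow> int" where
  "matrix_signature A =
     int (\<Sum>e | eigenvalue A e \<and> e > 0. order e (char_poly A)) -
     int (\<Sum>e | eigenvalue A e \<and> e < 0. order e (char_poly A))"

definition signature :: "closed_braid \<Rightarrow> int" where
  "signature L = matrix_signature (seifert_matrix L + transpose_mat (seifert_matrix L))"

section \<open>Weaving knots\<close>

text \<open>The closure of \<open>(\<sigma>\<^sub>1 \<sigma>\<^sub>2\<^sup>-\<^sup>1 \<sigma>\<^sub>3 \<dots> \<sigma>\<^sub>p\<^sub>-\<^sub>1\<^sup>\<plusminus>\<^sup>1)\<^sup>q\<close>.\<close>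

definition weaving :: "nat \<Rightarrow> nat \<Rightarrow> closed_braid" where
  "weaving p q = Closure p (concat (replicate q (map (\<lambda>i. Gen i (odd i)) [1..<p])))"

lemma is_closed_braid_weaving: "1 \<le> p \<Longrightarrow> is_closed_braid (weaving p q)"
  by (auto simp: is_closed_braid_def weaving_def)

section \<open>Normalisation\<close>

text \<open>The closure of \<open>\<sigma>\<^sub>1\<^sup>3\<close> is the right-handed trefoil.\<close>

lemma signature_right_handed_trefoil:
  "signature (Closure 2 [Gen 1 True, Gen 1 True, Gen 1 True]) = -2"
proof -
  let ?t = "Closure 2 [Gen 1 True, Gen 1 True, Gen 1 True]"
  define A where "A = seifert_matrix ?t + transpose_mat (seifert_matrix ?t)"
  have b: "seifert_basis (braid_word ?t) = [(0, 1), (1, 2)]"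
    unfolding seifert_basis_def by (simp add: upt_rec)
      (auto simp: less_Suc_eq numeral_eq_Suc)
  have A_eq: "A = mat 2 2 (\<lambda>(r, s). if r = s then -2 else 1)"
    unfolding A_def seifert_matrix_def Let_def b
    by (rule eq_matI)
      (auto simp: less_Suc_eq numeral_2_eq_2 linking_number_def over_crossings_def edges_def
        rectangle_def letter_sign_def)
  have c: "char_poly A = [:1, 1:] * [:3, 1:]"
    unfolding A_eq char_poly_def
    by (subst laplace_expansion_row[of _ 2 0])
      (auto simp: char_poly_matrix_def cofactor_def mat_delete_def det_single numeral_2_eq_2)
  have e: "eigenvalue A x \<longleftrightarrow> x = -1 \<or> x = -3" for x
  proof -
    have "A \<in> carrier_mat 2 2" by (simp add: A_eq)
    then have "eigenvalue A x \<longleftrightarrow> (x + 1) * (x + 3) = 0"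
      by (simp add: eigenvalue_root_char_poly c algebra_simps)
    then show ?thesis by (simp add: eq_neg_iff_add_eq_0)
  qed
  have o1: "order (-1) (char_poly A) = 1"
    unfolding c by (subst order_mult) (use order_power_n_n[of "-1::real" 1] in \<open>auto simp: order_0I\<close>)
  have o3: "order (-3) (char_poly A) = 1"
    unfolding c by (subst order_mult) (use order_power_n_n[of "-3::real" 1] in \<open>auto simp: order_0I\<close>)
  have sets: "{x. eigenvalue A x \<and> x > 0} = {}" "{x. eigenvalue A x \<and> x < 0} = {-1, -3}"
    by (auto simp: e)
  have "matrix_signature A = -2"
    unfolding matrix_signature_def sets using o1 o3 by simp
  then show ?thesis
    by (simp only: signature_def A_def)
qed

end

(* In the basis of loops between consecutive occurrences of a generator, the symmetrised Seifert form
   does not couple different generators of the same parity. Each generator alone contributes the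
   tridiagonal form with diagonal 2 and off-diagonal -1, which is positive definite, up to a sign
   that is negative for odd and positive for even generators. So the loops of even generators span
   a positive definite and those of odd generators a complementary negative definite subspace, and
   by Sylvester's law of inertia the signature is the difference of their dimensions, whatever the
   coupling between generators of different parity is. *)

theory Submission
  imports Defs
begin

section \<open>Real symmetric matrices\<close>

lemma order_prod_list_linear_factors:
  "order e (\<Prod>a\<leftarrow>as. [:- a, 1::'a::idom:]) = count_list as e"
proof (induction as)
  case (Cons a as)
  have lin: "order e [:- a, 1:] = (if a = e then 1 else 0)"
    using order_power_n_n[of a 1] by (auto intro: order_0I)
  have "[:- a, 1:] * (\<Prod>a\<leftarrow>as. [:- a, 1:]) \<noteq> 0"
    by (auto simp: prod_list_zero_iff simp del: mult_pCons_left)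
  then show ?case
    using Cons lin by (simp add: order_mult del: mult_pCons_left)
qed simp

lemma sum_count_list_filter:
  assumes "finite S"
  shows "(\<Sum>e\<in>S. count_list as e) = length (filter (\<lambda>a. a \<in> S) as)"
  using assms
proof (induction as)
  case (Cons a as)
  have "(\<Sum>e\<in>S. count_list (a # as) e) = (\<Sum>e\<in>S. if a = e then 1 else 0) + (\<Sum>e\<in>S. count_list as e)"
    unfolding sum.distrib[symmetric] by (rule sum.cong) auto
  then show ?case
    using Cons by simp
qed simp

section \<open>The spectral theorem for real symmetric matrices\<close>

text \<open>The characteristic polynomial has a complex root \<open>a\<close> with eigenvector
  \<open>z\<close>. Pairing \<open>A z\<close> with the conjugate of \<open>z\<close> in two ways,
  using that \<open>A\<close> is real and symmetric, gives \<open>cnj a = a\<close>.\<close>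

lemma real_symmetric_eigenvector_exists:
  fixes A :: "real mat"
  assumes A: "A \<in> carrier_mat n n" and sym: "transpose_mat A = A" and n: "n > 0"
  obtains v e where "v \<in> carrier_vec n" "v \<bullet> v = 1" "A *\<^sub>v v = e \<cdot>\<^sub>v v"
proof -
  let ?A = "map_mat complex_of_real A"
  have cA: "?A \<in> carrier_mat n n" using A by simp
  obtain as where as: "char_poly ?A = (\<Prod>a\<leftarrow>as. [:- a, 1:])" "length as = n"
    using char_poly_factorized[OF cA] by blast
  with n obtain a where "poly (char_poly ?A) a = 0"
    by (cases as) auto
  then have "eigenvalue ?A a"
    by (simp add: eigenvalue_root_char_poly[OF cA])
  then obtain z where z: "z \<in> carrier_vec n" "z \<noteq> 0\<^sub>v n" "?A *\<^sub>v z = a \<cdot>\<^sub>v z"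
    using cA unfolding eigenvalue_def eigenvector_def by auto
  have cnj_A: "conjugate (?A *\<^sub>v z) = ?A *\<^sub>v conjugate z"
    using A z(1) by (intro eq_vecI) (auto simp: scalar_prod_def)
  have symC: "transpose_mat ?A = ?A"
    using sym by (metis map_mat_transpose)
  have zz: "conjugate z \<bullet> z \<noteq> 0"
    using conjugate_square_eq_0_vec[OF z(1)] z(1,2) by (simp add: conjugate_vec_sprod_comm)
  have "cnj a * (conjugate z \<bullet> z) = conjugate (?A *\<^sub>v z) \<bullet> z"
    using z by (simp add: conjugate_smult_vec)
  also have "\<dots> = conjugate z \<bullet> (?A *\<^sub>v z)"
    unfolding cnj_A using transpose_vec_mult_scalar[OF cA z(1), of "conjugate z"] z(1) symC by simp
  also have "\<dots> = a * (conjugate z \<bullet> z)"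
    using z by simp
  finally have "cnj a = a" using zz by simp
  then obtain e where e: "a = complex_of_real e"
    by (metis Reals_cases Reals_cnj_iff)
  \<comment> \<open>The vector \<open>z\<close> may be genuinely complex. A real eigenvector comes
    from \<open>e\<close> being a root of the real characteristic polynomial.\<close>
  have "complex_of_real (poly (char_poly A) e) = 0"
    using \<open>poly (char_poly ?A) a = 0\<close> unfolding e of_real_hom.char_poly_hom[OF A] by simp
  then have "eigenvalue A e"
    by (simp add: eigenvalue_root_char_poly[OF A])
  then obtain w where w: "w \<in> carrier_vec n" "w \<noteq> 0\<^sub>v n" "A *\<^sub>v w = e \<cdot>\<^sub>v w"
    using A unfolding eigenvalue_def eigenvector_def by auto
  have pos: "w \<bullet> w > 0"
    using conjugate_square_greater_0_vec[OF w(1)] w(2) by simp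
  define c where "c = 1 / sqrt (w \<bullet> w)"
  have "c * c * (w \<bullet> w) = 1"
    using pos by (simp add: c_def)
  moreover have "(c \<cdot>\<^sub>v w) \<bullet> (c \<cdot>\<^sub>v w) = c * c * (w \<bullet> w)"
    using w(1) by (simp add: algebra_simps)
  moreover have "A *\<^sub>v (c \<cdot>\<^sub>v w) = e \<cdot>\<^sub>v (c \<cdot>\<^sub>v w)"
    using A w by (simp add: mult_mat_vec smult_smult_assoc mult.commute)
  ultimately show thesis
    using that[of "c \<cdot>\<^sub>v w" e] w(1) by simp
qed

text \<open>The Householder reflection that exchanges \<open>v\<close> with the first unit vector.\<close>

lemma orthogonal_mat_with_first_column:
  fixes v :: "real vec"
  assumes v: "v \<in> carrier_vec n" "v \<bullet> v = 1" and n: "n > 0"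
  obtains W where "W \<in> carrier_mat n n" "transpose_mat W * W = 1\<^sub>m n" "col W 0 = v"
proof -
  define u where "u i = v $ i - (if i = 0 then 1 else 0)" for i
  define s where "s = (\<Sum>i<n. u i * u i)"
  \<comment> \<open>This is the identity minus \<open>2 u u^T / s\<close> with \<open>u\<close> the
    difference of \<open>v\<close> and the first unit vector. If these agree, then
    \<open>s = 0\<close>, division by zero yields 0, and \<open>W\<close> is the identity, as
    desired.\<close>
  define W where "W = mat n n (\<lambda>(i, j). (if i = j then 1 else 0) - 2 * (u i * u j) / s)"
  have vv: "(\<Sum>i<n. v $ i * v $ i) = 1"
    using v by (simp add: scalar_prod_def lessThan_atLeast0)
  have "s = (\<Sum>i<n. v $ i * v $ i) - 2 * (\<Sum>i<n. if i = 0 then v $ i else 0) + (\<Sum>i<n. if i = 0 then 1 else 0)"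
    unfolding s_def u_def sum_distrib_left sum_subtractf[symmetric] sum.distrib[symmetric]
    by (rule sum.cong) (auto simp: algebra_simps)
  then have s: "s = 2 - 2 * v $ 0"
    using vv n by simp
  have s0: "u i = 0" if "s = 0" "i < n" for i
    using that by (simp add: s_def sum_nonneg_eq_0_iff)
  have "transpose_mat W * W = 1\<^sub>m n"
  proof (rule eq_matI)
    fix i j assume ij: "i < dim_row (1\<^sub>m n)" "j < dim_col (1\<^sub>m n)"
    have "(transpose_mat W * W) $$ (i, j) =
      (\<Sum>k<n. ((if k = i then 1 else 0) - 2 * (u k * u i) / s) * ((if k = j then 1 else 0) - 2 * (u k * u j) / s))"
      using ij by (simp add: W_def scalar_prod_def lessThan_atLeast0)
    also have "\<dots> = (\<Sum>k<n. if k = i then (if k = j then 1 else 0) - 2 * (u k * u j) / s else 0)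
      - (\<Sum>k<n. if k = j then 2 * (u k * u i) / s else 0) + (\<Sum>k<n. u k * u k * (4 * u i * u j / (s * s)))"
      unfolding sum_subtractf[symmetric] sum.distrib[symmetric]
      by (rule sum.cong) (auto simp: algebra_simps)
    also have "(\<Sum>k<n. u k * u k * (4 * u i * u j / (s * s))) = s * (4 * u i * u j / (s * s))"
      by (simp only: s_def sum_distrib_right)
    also have "\<dots> = 4 * (u i * u j) / s"
      by simp
    finally show "(transpose_mat W * W) $$ (i, j) = 1\<^sub>m n $$ (i, j)"
      using ij by (auto simp: algebra_simps)
  qed (auto simp: W_def)
  moreover have "col W 0 = v"
  proof (rule eq_vecI)
    fix i assume i: "i < dim_vec v"
    then have i: "i < n" using v by simp
    \<comment> \<open>Since \<open>v\<close> has norm 1, \<open>s\<close> equals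
      \<open>-2 * u 0\<close>, so the first column of \<open>W\<close> is the first unit vector plus
      \<open>u\<close>, that is \<open>v\<close>.\<close>
    have "2 * u 0 = - s" using s by (simp add: u_def)
    then have "2 * (u i * u 0) / s = - u i"
    proof (cases "s = 0")
      case False
      have "2 * (u i * u 0) / s = u i * (2 * u 0) / s" by simp
      then show ?thesis
        using False unfolding \<open>2 * u 0 = - s\<close> by simp
    qed (use s0[OF _ i] in simp)
    then show "col W 0 $ i = v $ i"
      using i n by (simp add: W_def) (simp add: u_def)
  qed (use v in \<open>auto simp: W_def\<close>)
  ultimately show thesis
    using that[of W] by (simp add: W_def)
qed

lemma mult_block_diag:
  fixes A1 A2 B1 B2 :: "'a::semiring_1 mat"
  assumes "A1 \<in> carrier_mat m m" "A2 \<in> carrier_mat m m" "B1 \<in> carrier_mat n n" "B2 \<in> carrier_mat n n"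
  shows "four_block_mat A1 (0\<^sub>m m n) (0\<^sub>m n m) B1 * four_block_mat A2 (0\<^sub>m m n) (0\<^sub>m n m) B2 =
    four_block_mat (A1 * A2) (0\<^sub>m m n) (0\<^sub>m n m) (B1 * B2)"
  using assms by (subst mult_four_block_mat[of _ m m _ n _ n _ _ m _ n]) auto

definition orthogonal_diagonalization :: "nat \<Rightarrow> real mat \<Rightarrow> real mat \<Rightarrow> real mat \<Rightarrow> bool" where
  "orthogonal_diagonalization n A P D \<longleftrightarrow> P \<in> carrier_mat n n \<and> D \<in> carrier_mat n n \<and>
    transpose_mat P * P = 1\<^sub>m n \<and> transpose_mat P * A * P = D \<and> diagonal_mat D"

lemma orthogonal_diagonalizationD:
  assumes "orthogonal_diagonalization n A P D"
  shows "P \<in> carrier_mat n n" "D \<in> carrier_mat n n" "transpose_mat P * P = 1\<^sub>m n"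
    "transpose_mat P * A * P = D" "diagonal_mat D"
  using assms by (auto simp: orthogonal_diagonalization_def)

text \<open>Deflation: in an orthonormal basis that starts with a unit eigenvector the matrix splits
  into a 1 by 1 block and a smaller symmetric block, to which the induction hypothesis
  applies.\<close>

lemma real_symmetric_diagonalizable:
  fixes A :: "real mat"
  assumes "A \<in> carrier_mat n n" "transpose_mat A = A"
  shows "\<exists>P D. orthogonal_diagonalization n A P D"
  using assms
proof (induction n arbitrary: A)
  case 0
  then show ?case
    by (intro exI[of _ "1\<^sub>m 0"] exI[of _ A]) (auto simp: orthogonal_diagonalization_def diagonal_mat_def)
next
  case (Suc n)
  note A = Suc.prems(1)
  obtain v e where v: "v \<in> carrier_vec (Suc n)" "v \<bullet> v = 1" "A *\<^sub>v v = e \<cdot>\<^sub>v v"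
    using real_symmetric_eigenvector_exists[OF Suc.prems] by auto
  obtain W where W: "W \<in> carrier_mat (Suc n) (Suc n)" "transpose_mat W * W = 1\<^sub>m (Suc n)" "col W 0 = v"
    using orthogonal_mat_with_first_column[OF v(1,2)] by auto
  define M where "M = transpose_mat W * A * W"
  have M: "M \<in> carrier_mat (Suc n) (Suc n)" using A W by (simp add: M_def)
  have symM: "transpose_mat M = M"
    using A W Suc.prems(2) unfolding M_def
    by (simp add: transpose_mult[of _ "Suc n" "Suc n" _ "Suc n"] assoc_mult_mat[of _ "Suc n" "Suc n" _ "Suc n" _ "Suc n"])
  \<comment> \<open>Column 0 of \<open>W\<close> is an eigenvector and the columns of
    \<open>W\<close> are orthonormal. Symmetry of \<open>M\<close> then clears row 0 as
    well.\<close>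
  have "M $$ (i, 0) = (if i = 0 then e else 0)" if i: "i < Suc n" for i
  proof -
    have "M $$ (i, 0) = col W i \<bullet> (A *\<^sub>v col W 0)"
      using A W(1) i unfolding M_def
      by (subst assoc_mult_mat[of _ "Suc n" "Suc n" _ "Suc n" _ "Suc n"]) (auto simp: mult_mat_vec_def)
    also have "\<dots> = e * (col W i \<bullet> col W 0)"
      using v W(1,3) i by simp
    also have "col W i \<bullet> col W 0 = (transpose_mat W * W) $$ (i, 0)"
      using W(1) i by simp
    finally show ?thesis using W(2) i by simp
  qed
  moreover have "M $$ (0, i) = M $$ (i, 0)" if "i < Suc n" for i
    using arg_cong[OF symM, of "\<lambda>X. X $$ (i, 0)"] M that by simp
  moreover obtain B where B: "B = mat n n (\<lambda>(i, j). M $$ (Suc i, Suc j))" by blast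
  ultimately have Mb: "M = four_block_mat (e \<cdot>\<^sub>m 1\<^sub>m 1) (0\<^sub>m 1 n) (0\<^sub>m n 1) B"
    using M by (intro eq_matI) (auto simp: Suc_diff_Suc)
  have symB: "transpose_mat B = B"
  proof (rule eq_matI)
    fix i j assume "i < dim_row B" "j < dim_col B"
    then show "transpose_mat B $$ (i, j) = B $$ (i, j)"
      using arg_cong[OF symM, of "\<lambda>X. X $$ (Suc i, Suc j)"] M by (simp add: B)
  qed (auto simp: B)
  have Bc: "B \<in> carrier_mat n n" by (simp add: B)
  obtain Q E where QE: "orthogonal_diagonalization n B Q E"
    using Suc.IH[OF Bc symB] by blast
  note Q = orthogonal_diagonalizationD[OF QE]
  define V where "V = four_block_mat (1\<^sub>m 1) (0\<^sub>m 1 n) (0\<^sub>m n 1) Q"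
  let ?D = "four_block_mat (e \<cdot>\<^sub>m 1\<^sub>m 1) (0\<^sub>m 1 n) (0\<^sub>m n 1) E"
  have Qc: "V \<in> carrier_mat (Suc n) (Suc n)"
    using four_block_carrier_mat[of "1\<^sub>m 1" 1 1 Q n n] Q(1) by (simp add: V_def)
  have tQ: "transpose_mat V = four_block_mat (1\<^sub>m 1) (0\<^sub>m 1 n) (0\<^sub>m n 1) (transpose_mat Q)"
    unfolding V_def using Q(1) by (subst transpose_four_block_mat[of _ 1 1 _ n _ n]) auto
  have QQ: "transpose_mat V * V = 1\<^sub>m (Suc n)"
    unfolding tQ unfolding V_def using mult_block_diag[of "1\<^sub>m 1" 1 "1\<^sub>m 1" "transpose_mat Q" n Q] Q(1,3) by simp
  have QMQ: "transpose_mat V * M * V = ?D"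
    unfolding tQ Mb unfolding V_def using Q(1,2,4) Bc
      mult_block_diag[of "1\<^sub>m 1" 1 "e \<cdot>\<^sub>m 1\<^sub>m 1" "transpose_mat Q" n B]
      mult_block_diag[of "e \<cdot>\<^sub>m 1\<^sub>m 1" 1 "1\<^sub>m 1" "transpose_mat Q * B" n Q]
    by simp
  let ?P = "W * V"
  have tP: "transpose_mat ?P = transpose_mat V * transpose_mat W"
    using W(1) Qc by (rule transpose_mult)
  have "transpose_mat ?P * ?P = transpose_mat V * (transpose_mat W * W) * V"
    unfolding tP using W(1) Qc by (simp add: assoc_mult_mat[of _ "Suc n" "Suc n" _ "Suc n" _ "Suc n"])
  then have "transpose_mat ?P * ?P = 1\<^sub>m (Suc n)"
    using W(2) QQ Qc by simp
  moreover have "transpose_mat ?P * A * ?P = transpose_mat V * M * V"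
    unfolding tP M_def using W(1) A Qc by (simp add: assoc_mult_mat[of _ "Suc n" "Suc n" _ "Suc n" _ "Suc n"])
  moreover have "diagonal_mat ?D"
    using Q(2,5) by (auto simp: diagonal_mat_def)
  ultimately show ?case
    using QMQ W(1) Qc Q(2) unfolding orthogonal_diagonalization_def
    by (intro exI[of _ ?P] exI[of _ ?D] conjI) auto
qed

section \<open>Signature and Sylvester's law of inertia\<close>

lemma length_filter_diag_mat:
  assumes "D \<in> carrier_mat n n"
  shows "length (filter R (diag_mat D)) = card {i. i < n \<and> R (D $$ (i, i))}"
  using assms by (auto simp: diag_mat_def length_filter_conv_card intro!: arg_cong[where f = card])

text \<open>\<open>A\<close> is similar to \<open>D\<close>, so its characteristic polynomial splits
  over the diagonal of \<open>D\<close> and the order of a root is its number of occurrences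
  there.\<close>

lemma matrix_signature_diagonalized:
  fixes A :: "real mat"
  assumes A: "A \<in> carrier_mat n n" and PD: "orthogonal_diagonalization n A P D"
  shows "matrix_signature A = int (card {i. i < n \<and> D $$ (i, i) > 0}) - int (card {i. i < n \<and> D $$ (i, i) < 0})"
proof -
  note P = orthogonal_diagonalizationD(1)[OF PD] and D = orthogonal_diagonalizationD(2)[OF PD]
    and PP = orthogonal_diagonalizationD(3)[OF PD] and PAP = orthogonal_diagonalizationD(4)[OF PD]
    and diag = orthogonal_diagonalizationD(5)[OF PD]
  have PP': "P * transpose_mat P = 1\<^sub>m n"
    using mat_mult_left_right_inverse[OF _ P PP] P by simp
  have "P * D * transpose_mat P = (P * transpose_mat P) * A * (P * transpose_mat P)"
    unfolding PAP[symmetric] using A P by (simp add: assoc_mult_mat[of _ n n _ n _ n])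
  then have "similar_mat A D"
    using A P D PP PP' by (intro similar_matI[of _ _ P "transpose_mat P" n]) auto
  moreover have "upper_triangular D"
    using diag D by (auto simp: diagonal_mat_def)
  ultimately have c: "char_poly A = (\<Prod>a\<leftarrow>diag_mat D. [:- a, 1:])"
    using char_poly_similar char_poly_upper_triangular[OF D] by metis
  have ev: "eigenvalue A e \<longleftrightarrow> e \<in> set (diag_mat D)" for e
    unfolding eigenvalue_root_char_poly[OF A] c by (auto simp: poly_prod_list prod_list_zero_iff)
  have "(\<Sum>e | eigenvalue A e \<and> R e. order e (char_poly A)) = card {i. i < n \<and> R (D $$ (i, i))}" for R
    unfolding c order_prod_list_linear_factors ev
    by (subst sum_count_list_filter)
      (auto simp: length_filter_diag_mat[OF D, symmetric] intro!: arg_cong[where f = length] filter_cong)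
  then show ?thesis
    by (simp add: matrix_signature_def)
qed

text \<open>One half of the law of inertia. If \<open>C\<close> had more elements than there are
  positive diagonal entries, some nonzero vector supported on \<open>C\<close> would be orthogonal
  to all eigenvectors of positive eigenvalues, and the form would be at most 0 on it.\<close>

lemma card_le_positive_diagonal:
  fixes A :: "real mat"
  assumes A: "A \<in> carrier_mat n n" and PD: "orthogonal_diagonalization n A P D"
    and C: "C \<subseteq> {..<n}"
    and pos: "\<And>x. x \<in> carrier_vec n \<Longrightarrow> x \<noteq> 0\<^sub>v n \<Longrightarrow> (\<And>i. i < n \<Longrightarrow> i \<notin> C \<Longrightarrow> x $ i = 0) \<Longrightarrow> 0 < x \<bullet> (A *\<^sub>v x)"
  shows "card C \<le> card {i. i < n \<and> D $$ (i, i) > 0}"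
proof (rule ccontr)
  note P = orthogonal_diagonalizationD(1)[OF PD] and D = orthogonal_diagonalizationD(2)[OF PD]
    and PP = orthogonal_diagonalizationD(3)[OF PD] and PAP = orthogonal_diagonalizationD(4)[OF PD]
    and diag = orthogonal_diagonalizationD(5)[OF PD]
  let ?I = "{i. i < n \<and> D $$ (i, i) > 0}"
  assume less: "\<not> card C \<le> card ?I"
  have fin: "finite C" "finite ?I" using C finite_subset by auto
  obtain f where f: "f ` ?I \<subseteq> C" "inj_on f ?I"
    using card_le_inj[OF fin(2,1)] less by auto
  have "card (f ` ?I) < card C"
    using f(2) less by (simp add: card_image)
  then have "f ` ?I \<noteq> C" by blast
  then obtain r where r: "r \<in> C" "r \<notin> f ` ?I"
    using f(1) by blast
  define g where "g i = (if i \<in> C then if i \<in> f ` ?I then col P (the_inv_into ?I f i) else 0\<^sub>v n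
    else unit_vec n i)" for i
  have g: "g i \<in> carrier_vec n" for i
    using P by (auto simp: g_def)
  define R where "R = mat\<^sub>r n n (\<lambda>i. if i = r then 0\<^sub>v n else g i)"
  have Rc: "R \<in> carrier_mat n n" by (simp add: R_def)
  have R: "R = mat\<^sub>r n n g"
    unfolding R_def using r by (intro arg_cong[where f = "mat\<^sub>r n n"]) (auto simp: g_def)
  have "det R = 0"
    unfolding R_def using r C g by (intro det_row_0) auto
  then obtain x where x: "x \<in> carrier_vec n" "x \<noteq> 0\<^sub>v n" "R *\<^sub>v x = 0\<^sub>v n"
    using det_0_iff_vec_prod_zero[OF Rc] by blast
  have gx: "g i \<bullet> x = 0" if "i < n" for i
    using arg_cong[OF x(3), of "\<lambda>y. y $ i"] that g by (simp add: R)
  have "x $ i = 0" if "i < n" "i \<notin> C" for i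
    using gx[OF that(1)] that x(1) by (simp add: g_def)
  then have "0 < x \<bullet> (A *\<^sub>v x)"
    using pos x by blast
  \<comment> \<open>The coordinates of \<open>x\<close> in the eigenbasis, which vanish wherever
    \<open>D\<close> has a positive entry.\<close>
  define y where "y = transpose_mat P *\<^sub>v x"
  have y: "y \<in> carrier_vec n" using P x by (simp add: y_def)
  have y0: "y $ i = 0" if "i \<in> ?I" for i
  proof -
    have "f i < n" using f(1) C that by auto
    moreover have "the_inv_into ?I f (f i) = i"
      using f(2) that by (rule the_inv_into_f_f)
    ultimately have "col P i \<bullet> x = 0"
      using gx[of "f i"] f(1) that by (auto simp: g_def)
    then show ?thesis
      using that P by (simp add: y_def)
  qed
  have PP': "P * transpose_mat P = 1\<^sub>m n"
    using mat_mult_left_right_inverse[OF _ P PP] P by simp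
  have x_y: "x = P *\<^sub>v y"
    unfolding y_def using assoc_mult_mat_vec[of P n n "transpose_mat P" n x] P PP' x(1) by simp
  have "x \<bullet> (A *\<^sub>v x) = (A *\<^sub>v x) \<bullet> (P *\<^sub>v y)"
    using A x(1) by (subst x_y[symmetric]) (simp add: comm_scalar_prod[of _ n])
  also have "\<dots> = (transpose_mat P *\<^sub>v (A *\<^sub>v x)) \<bullet> y"
    using A P x(1) y by (intro transpose_vec_mult_scalar[symmetric]) auto
  also have "transpose_mat P *\<^sub>v (A *\<^sub>v x) = D *\<^sub>v y"
    unfolding PAP[symmetric] x_y using A P y
    by (simp add: assoc_mult_mat_vec[of _ n n _ n])
  also have "(D *\<^sub>v y) \<bullet> y = (\<Sum>i<n. D $$ (i, i) * (y $ i)\<^sup>2)"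
  proof -
    have "(D *\<^sub>v y) $ i = D $$ (i, i) * y $ i" if "i < n" for i
    proof -
      have "(D *\<^sub>v y) $ i = (\<Sum>j<n. D $$ (i, j) * y $ j)"
        using that D y by (simp add: scalar_prod_def lessThan_atLeast0)
      also have "\<dots> = (\<Sum>j<n. if j = i then D $$ (i, i) * y $ i else 0)"
        using diag D that by (intro sum.cong) (auto simp: diagonal_mat_def)
      finally show ?thesis using that by simp
    qed
    then show ?thesis
      using D y by (simp add: scalar_prod_def lessThan_atLeast0 power2_eq_square mult.assoc)
  qed
  also have "\<dots> \<le> 0"
  proof (rule sum_nonpos)
    fix i assume "i \<in> {..<n}"
    then show "D $$ (i, i) * (y $ i)\<^sup>2 \<le> 0"
      using y0[of i] by (cases "D $$ (i, i) > 0") (auto intro: mult_nonpos_nonneg)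
  qed
  finally show False
    using \<open>0 < x \<bullet> (A *\<^sub>v x)\<close> by simp
qed

text \<open>The bound is applied to \<open>A\<close> with \<open>C\<close> and to \<open>- A\<close>
  with the complement of \<open>C\<close>. Positive and negative diagonal entries together number at
  most \<open>n\<close>, so both bounds are equalities.\<close>

theorem matrix_signature_definite_split:
  fixes A :: "real mat"
  assumes A: "A \<in> carrier_mat n n" and sym: "transpose_mat A = A" and C: "C \<subseteq> {..<n}"
    and pos: "\<And>x. x \<in> carrier_vec n \<Longrightarrow> x \<noteq> 0\<^sub>v n \<Longrightarrow> (\<And>i. i < n \<Longrightarrow> i \<notin> C \<Longrightarrow> x $ i = 0) \<Longrightarrow> 0 < x \<bullet> (A *\<^sub>v x)"
    and neg: "\<And>x. x \<in> carrier_vec n \<Longrightarrow> x \<noteq> 0\<^sub>v n \<Longrightarrow> (\<And>i. i < n \<Longrightarrow> i \<in> C \<Longrightarrow> x $ i = 0) \<Longrightarrow> x \<bullet> (A *\<^sub>v x) < 0"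
  shows "matrix_signature A = int (card C) - int (card ({..<n} - C))"
proof -
  obtain P D where PD: "orthogonal_diagonalization n A P D"
    using real_symmetric_diagonalizable[OF A sym] by blast
  note D = orthogonal_diagonalizationD(2)[OF PD]
  let ?p = "{i. i < n \<and> D $$ (i, i) > 0}" and ?m = "{i. i < n \<and> D $$ (i, i) < 0}"
  have p: "card C \<le> card ?p"
    using card_le_positive_diagonal[OF A PD C pos] .
  have "card ({..<n} - C) \<le> card {i. i < n \<and> (- D) $$ (i, i) > 0}"
  proof (rule card_le_positive_diagonal[of "- A" n P])
    show "orthogonal_diagonalization n (- A) P (- D)"
      using A orthogonal_diagonalizationD[OF PD]
      by (auto simp: orthogonal_diagonalization_def diagonal_mat_def)
    show "0 < x \<bullet> (- A *\<^sub>v x)"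
      if "x \<in> carrier_vec n" "x \<noteq> 0\<^sub>v n" "\<And>i. i < n \<Longrightarrow> i \<notin> {..<n} - C \<Longrightarrow> x $ i = 0" for x
      using neg[OF that(1,2)] that A by auto
  qed (use A in auto)
  also have "{i. i < n \<and> (- D) $$ (i, i) > 0} = ?m"
    using D by auto
  finally have m: "card ({..<n} - C) \<le> card ?m" .
  have "card ?p + card ?m = card (?p \<union> ?m)"
    by (intro card_Un_disjoint[symmetric]) auto
  also have "\<dots> \<le> card {..<n}"
    by (intro card_mono) auto
  also have "\<dots> = card C + card ({..<n} - C)"
    using C by (metis card_Diff_subset card_mono finite_lessThan finite_subset le_add_diff_inverse)
  finally show ?thesis
    using p m matrix_signature_diagonalized[OF A PD] by simp
qed

section \<open>The Seifert form of a weaving knot\<close>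

text \<open>Opposite sides run in opposite directions, so the signed count factors into one term for
  the vertical sides of the first rectangle and one for the horizontal sides of the second.\<close>

lemma over_crossings_rectangle:
  assumes "x1 < x2" "y1 < y2" "u1 < u2" "v1 < v2"
  shows "over_crossings (rectangle x1 x2 y1 y2) (rectangle u1 u2 v1 v2) =
    (of_bool (u1 < x1 \<and> x1 < u2) - of_bool (u1 < x2 \<and> x2 < u2)) *
    (of_bool (y1 < v1 \<and> v1 < y2) - of_bool (y1 < v2 \<and> v2 < y2))"
  using assms by (simp add: over_crossings_def edges_def rectangle_def)

text \<open>For \<open>i = i'\<close> only the lower side of the push-off lies within the heights of
  the loop, and only the upper side of the loop within those of the push-off. For generators at
  least 2 apart the height ranges are disjoint.\<close>

lemma linking_number_loop_push_off:
  fixes i i' :: int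
  assumes x: "x1 < x2" "u1 < u2" and i: "\<bar>i - i'\<bar> \<noteq> 1"
  shows "linking_number (rectangle x1 x2 (4 * i) (4 * i + 4)) (rectangle u1 u2 (4 * i' + 1) (4 * i' + 5)) =
    (if i = i' then
      (of_bool (u1 < x1 \<and> x1 < u2) - of_bool (u1 < x2 \<and> x2 < u2) -
       of_bool (x1 < u1 \<and> u1 < x2) + of_bool (x1 < u2 \<and> u2 < x2)) / 2
    else 0)"
proof -
  consider "i = i'" | "i + 2 \<le> i'" | "i' + 2 \<le> i"
    using i by linarith
  then show ?thesis
    unfolding linking_number_def using x
    by cases (simp_all add: over_crossings_rectangle)
qed

section \<open>The Seifert basis of a periodic braid word\<close>

lemma nth_concat_replicate:
  "j < q * length xs \<Longrightarrow> concat (replicate q xs) ! j = xs ! (j mod length xs)"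
proof (induction q arbitrary: j)
  case (Suc q)
  then show ?case
    by (cases "j < length xs") (auto simp: nth_append le_mod_geq)
qed simp

lemma filter_eq_upt: "filter (\<lambda>k. k = a) [0..<n] = (if a < n then [a] else [])"
  by (induction n) auto

lemma mod_eq_imp_add_le:
  fixes u v m :: nat
  assumes "u < v" "u mod m = v mod m"
  shows "u + m \<le> v"
proof -
  have "m dvd v - u"
    using assms by (metis less_imp_le_nat mod_eq_dvd_iff_nat)
  then show ?thesis
    using assms(1) dvd_imp_le[of m "v - u"] by simp
qed

text \<open>Each generator occurs once per period, so consecutive occurrences are exactly
  \<open>m\<close> positions apart. Positions in the last period have no successor, whence
  \<open>q - 1\<close>.\<close>

lemma seifert_basis_periodic:
  assumes m: "m > 0" and len: "length w = m * q"
    and strand: "\<And>j. j < m * q \<Longrightarrow> strand (w ! j) = Suc (j mod m)"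
  shows "seifert_basis w = map (\<lambda>r. (r, r + m)) [0..<m * (q - 1)]"
proof -
  let ?L = "m * q"
  let ?R = "\<lambda>(j, k). j < k \<and> strand (w ! j) = strand (w ! k) \<and>
    (\<forall>l. j < l \<and> l < k \<longrightarrow> strand (w ! l) \<noteq> strand (w ! j))"
  have R: "?R (j, k) \<longleftrightarrow> k = j + m" if "j < ?L" "k < ?L" for j k
  proof
    assume *: "?R (j, k)"
    then have ge: "j + m \<le> k"
      using that by (intro mod_eq_imp_add_le) (auto simp: strand)
    have "k \<le> j + m"
    proof (rule ccontr)
      assume less: "\<not> k \<le> j + m"
      with * m have "strand (w ! (j + m)) \<noteq> strand (w ! j)" by auto
      with less that show False by (simp add: strand)
    qed
    with ge show "k = j + m" by simp
  next
    assume k: "k = j + m"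
    have "l mod m \<noteq> j mod m" if "j < l" "l < j + m" for l
      using mod_eq_imp_add_le[of j l m] that by auto
    then show "?R (j, k)"
      using that k m by (auto simp: strand)
  qed
  have "seifert_basis w = concat (map (\<lambda>j. filter ?R (map (Pair j) [0..<?L])) [0..<?L])"
    by (simp only: seifert_basis_def len product_concat_map filter_concat map_map o_def)
  also have "\<dots> = concat (map (\<lambda>j. if j + m < ?L then [(j, j + m)] else []) [0..<?L])"
  proof (intro arg_cong[where f = concat] map_cong refl)
    fix j assume "j \<in> set [0..<?L]"
    then have "filter (\<lambda>k. ?R (j, k)) [0..<?L] = filter (\<lambda>k. k = j + m) [0..<?L]"
      by (intro filter_cong refl R) auto
    then show "filter ?R (map (Pair j) [0..<?L]) = (if j + m < ?L then [(j, j + m)] else [])"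
      unfolding filter_map o_def by (simp add: filter_eq_upt)
  qed
  \<comment> \<open>The last \<open>m\<close> positions start no loop. For \<open>q = 0\<close> all
    lists are empty.\<close>
  also have "\<dots> = concat (map (\<lambda>j. if j + m < ?L then [(j, j + m)] else []) [0..<?L - m])"
  proof -
    have "[0..<?L] = [0..<?L - m] @ [?L - m..<?L]"
      using upt_add_eq_append[of 0 "?L - m" m] by (cases q) (auto simp: add.commute)
    moreover have "concat (map (\<lambda>j. if j + m < ?L then [(j, j + m)] else []) [?L - m..<?L]) = []"
      by auto
    ultimately show ?thesis by simp
  qed
  also have "\<dots> = concat (map (\<lambda>j. [(j, j + m)]) [0..<?L - m])"
    by (intro arg_cong[where f = concat] map_cong) auto
  finally show ?thesis
    by (simp add: diff_mult_distrib2)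
qed

section \<open>Positive definiteness of the tridiagonal form\<close>

text \<open>The form is a sum of squares: those of the first \<open>m\<close> values of
  \<open>f\<close> and those of the differences \<open>f r - f (r + m)\<close>. If all differences
  vanished, \<open>f\<close> would be \<open>m\<close>-periodic, contrary to its finite
  support.\<close>

lemma shift_form_positive:
  fixes f :: "nat \<Rightarrow> real"
  assumes m: "m > 0" and supp: "\<And>r. r \<ge> N \<Longrightarrow> f r = 0" and ne: "f t \<noteq> 0"
  shows "0 < 2 * (\<Sum>r<N. f r * f r) - 2 * (\<Sum>r<N. f r * f (r + m))"
proof -
  have "(\<Sum>r<m + N. f r * f r) = (\<Sum>r<m. f r * f r) + (\<Sum>r<N. f (r + m) * f (r + m))"
    by (induction N) (auto simp: add_ac)
  moreover have "(\<Sum>r<m + N. f r * f r) = (\<Sum>r<N. f r * f r)"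
    using supp by (intro sum.mono_neutral_right) auto
  moreover have "(\<Sum>r<N. (f r - f (r + m))\<^sup>2) =
    (\<Sum>r<N. f r * f r) + (\<Sum>r<N. f (r + m) * f (r + m)) - 2 * (\<Sum>r<N. f r * f (r + m))"
    unfolding sum_distrib_left sum.distrib[symmetric] sum_subtractf[symmetric]
    by (rule sum.cong) (auto simp: power2_eq_square algebra_simps)
  ultimately have eq: "2 * (\<Sum>r<N. f r * f r) - 2 * (\<Sum>r<N. f r * f (r + m)) =
    (\<Sum>r<m. f r * f r) + (\<Sum>r<N. (f r - f (r + m))\<^sup>2)"
    by simp
  have nonneg: "(\<Sum>r<m. f r * f r) \<ge> 0" "(\<Sum>r<N. (f r - f (r + m))\<^sup>2) \<ge> 0"
    by (auto intro: sum_nonneg)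
  have "(\<Sum>r<N. (f r - f (r + m))\<^sup>2) \<noteq> 0"
  proof
    assume "(\<Sum>r<N. (f r - f (r + m))\<^sup>2) = 0"
    then have "\<forall>r<N. f r = f (r + m)"
      by (subst (asm) sum_nonneg_eq_0_iff) auto
    \<comment> \<open>From \<open>N\<close> on both sides are zero, so the equation extends to all
      \<open>r\<close>.\<close>
    then have step: "f r = f (r + m)" for r
      using supp by (cases "r < N") auto
    have "f t = f (t + m * d)" for d
      by (induction d) (use step in \<open>auto simp: add_ac\<close>, metis add.assoc add.commute step)
    then show False
      using ne supp[of "t + m * N"] m by (metis le_add2 mult.commute mult_le_mono1 nat_mult_1 Suc_leI One_nat_def order_trans)
  qed
  with nonneg show ?thesis unfolding eq by linarith
qed

section \<open>The symmetrised Seifert form on loops of equal parity\<close>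

text \<open>With \<open>Suc m\<close> strands, \<open>m\<close> is the number of generators and the
  period of the braid word.\<close>

definition sym_seifert :: "nat \<Rightarrow> nat \<Rightarrow> real mat" where
  "sym_seifert m q = seifert_matrix (weaving (Suc m) q) + transpose_mat (seifert_matrix (weaving (Suc m) q))"

context
  fixes m q :: nat
  assumes m: "m > 0"
begin

abbreviation "word \<equiv> braid_word (weaving (Suc m) q)"

lemma length_word: "length word = m * q"
  by (simp add: weaving_def length_concat sum_list_replicate)

text \<open>Residues start at 0 and generators at 1, so even residues carry the odd generators,
  which are the positive crossings.\<close>

lemma nth_word: "j < m * q \<Longrightarrow> word ! j = Gen (Suc (j mod m)) (even (j mod m))"
  using nth_concat_replicate[of j q "map (\<lambda>i. Gen i (odd i)) [1..<Suc m]"] m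
  by (simp add: weaving_def mult.commute del: upt_Suc)

lemma basis_word: "seifert_basis word = map (\<lambda>r. (r, r + m)) [0..<m * (q - 1)]"
  by (rule seifert_basis_periodic[OF m length_word]) (simp add: nth_word)

lemma sym_seifert_carrier: "sym_seifert m q \<in> carrier_mat (m * (q - 1)) (m * (q - 1))"
  by (simp add: sym_seifert_def seifert_matrix_def Let_def basis_word)

lemma transpose_sym_seifert: "transpose_mat (sym_seifert m q) = sym_seifert m q"
  unfolding sym_seifert_def seifert_matrix_def Let_def basis_word
  by (intro eq_matI) auto

text \<open>Equal parity means equal crossing signs, so the push-off shifts by the same unit
  \<open>?a\<close> at both of its bands, and it excludes adjacent generators. Only loops that
  coincide or share a band can then link.\<close>

lemma linking_number_same_parity:
  assumes r: "r < m * (q - 1)" and s: "s < m * (q - 1)" and par: "even (r mod m) \<longleftrightarrow> even (s mod m)"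
  shows "linking_number (seifert_loop word (r, r + m)) (seifert_push_off word (s, s + m)) =
    (if r = s then if even (r mod m) then -1 else 1
     else if s = r + m then if even (r mod m) then 0 else -1
     else if r = s + m then if even (r mod m) then 1 else 0
     else 0)"
proof -
  let ?a = "if even (r mod m) then 1 else -1 :: int"
  have "t < m * q" "t + m < m * q" if "t < m * (q - 1)" for t
    using that by (cases q; simp)+
  note bounds = this[OF r] this[OF s]
  have loop: "seifert_loop word (r, r + m) = rectangle (4 * int r) (4 * int (r + m))
      (4 * int (Suc (r mod m))) (4 * int (Suc (r mod m)) + 4)"
    using bounds by (simp add: Let_def nth_word)
  have push: "seifert_push_off word (s, s + m) = rectangle (4 * int s + ?a) (4 * int (s + m) + ?a)
      (4 * int (Suc (s mod m)) + 1) (4 * int (Suc (s mod m)) + 5)"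
    using bounds par by (simp add: Let_def nth_word letter_sign_def)
  show ?thesis
  proof (cases "r mod m = s mod m")
    case False
    have "\<bar>int (Suc u) - int (Suc v)\<bar> \<noteq> 1" if "even u \<longleftrightarrow> even v" for u v :: nat
      using that by presburger
    from this[OF par] have "\<bar>int (Suc (r mod m)) - int (Suc (s mod m))\<bar> \<noteq> 1" .
    then show ?thesis
      unfolding loop push using False m by (subst linking_number_loop_push_off) auto
  next
    case True
    from mod_eq_imp_add_le[of r s m] mod_eq_imp_add_le[of s r m] True
    consider "r = s" | "s = r + m" | "r = s + m" | "r + m < s" | "s + m < r"
      by fastforce
    then show ?thesis
      unfolding loop push
      by (subst linking_number_loop_push_off; cases) (use m True in auto)
  qed
qed

lemma sym_seifert_same_parity:
  assumes "r < m * (q - 1)" "s < m * (q - 1)" "even (r mod m) \<longleftrightarrow> even (s mod m)"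
  shows "sym_seifert m q $$ (r, s) = (if even (r mod m) then - 1 else 1) *
    ((if s = r then 2 else 0) - (if s = r + m then 1 else 0) - (if r = s + m then 1 else 0))"
proof -
  have "sym_seifert m q $$ (r, s) =
    linking_number (seifert_loop word (r, r + m)) (seifert_push_off word (s, s + m)) +
    linking_number (seifert_loop word (s, s + m)) (seifert_push_off word (r, r + m))"
    using assms(1,2) by (simp add: sym_seifert_def seifert_matrix_def Let_def basis_word
        del: seifert_loop.simps seifert_push_off.simps)
  also have "\<dots> = (if even (r mod m) then - 1 else 1) *
    ((if s = r then 2 else 0) - (if s = r + m then 1 else 0) - (if r = s + m then 1 else 0))"
    unfolding linking_number_same_parity[OF assms] linking_number_same_parity[OF assms(2,1) assms(3)[symmetric]]
    using m by simp
  finally show ?thesis .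
qed

text \<open>On vectors supported on one parity class the form is, up to sign, the shift form above:
  negative definite for even residues, positive definite for odd ones.\<close>

lemma sym_seifert_form:
  assumes x: "x \<in> carrier_vec (m * (q - 1))" "x \<noteq> 0\<^sub>v (m * (q - 1))"
    and supp: "\<And>i. i < m * (q - 1) \<Longrightarrow> even (i mod m) \<noteq> b \<Longrightarrow> x $ i = 0"
  shows "0 < (if b then - 1 else 1) * (x \<bullet> (sym_seifert m q *\<^sub>v x))"
proof -
  let ?N = "m * (q - 1)" and ?e = "if b then - 1 else 1 :: real"
  \<comment> \<open>Extension of \<open>x\<close> by zero, so that \<open>f (r + m)\<close> makes
    sense past the last loop.\<close>
  define f where "f r = (if r < ?N then x $ r else 0)" for r
  have "x \<bullet> (sym_seifert m q *\<^sub>v x) = (\<Sum>r<?N. \<Sum>s<?N. f r * sym_seifert m q $$ (r, s) * f s)"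
    using x(1) sym_seifert_carrier
    by (simp add: scalar_prod_def sum_distrib_left lessThan_atLeast0 mult.assoc f_def)
  also have "\<dots> = (\<Sum>r<?N. \<Sum>s<?N. ?e * ((if s = r then 2 * (f r * f r) else 0)
    - (if s = r + m then f r * f (r + m) else 0) - (if r = s + m then f s * f (s + m) else 0)))"
  proof (intro sum.cong refl)
    fix r s assume "r \<in> {..<?N}" "s \<in> {..<?N}"
    then show "f r * sym_seifert m q $$ (r, s) * f s =
      ?e * ((if s = r then 2 * (f r * f r) else 0)
      - (if s = r + m then f r * f (r + m) else 0) - (if r = s + m then f s * f (s + m) else 0))"
    proof (cases "even (r mod m) = b \<and> even (s mod m) = b")
      case True
      with \<open>r \<in> _\<close> \<open>s \<in> _\<close> show ?thesis
        using m by (subst sym_seifert_same_parity) auto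
    \<comment> \<open>Entries coupling different parities are unknown here, but one of the two
      coordinates that multiply them is zero.\<close>
    next
      case False
      with \<open>r \<in> _\<close> \<open>s \<in> _\<close> have "f r = 0 \<or> f s = 0"
        using supp by (auto simp: f_def)
      with False show ?thesis by auto
    qed
  qed
  also have "\<dots> = ?e * ((\<Sum>r<?N. \<Sum>s<?N. if s = r then 2 * (f r * f r) else 0)
    - (\<Sum>r<?N. \<Sum>s<?N. if s = r + m then f r * f (r + m) else 0)
    - (\<Sum>s<?N. \<Sum>r<?N. if r = s + m then f s * f (s + m) else 0))"
    \<comment> \<open>Swapping the sums turns the lower off-diagonal part into a copy of the upper
      one.\<close>
    unfolding sum_distrib_left[symmetric] sum_subtractf
    by (subst (3) sum.swap) simp
  also have "\<dots> = ?e * (2 * (\<Sum>r<?N. f r * f r) - 2 * (\<Sum>r<?N. f r * f (r + m)))"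
  proof -
    have "(\<Sum>s<?N. if s = r + m then f r * f (r + m) else 0) = f r * f (r + m)" for r
      by (auto simp: f_def)
    then show ?thesis by (simp add: sum_distrib_left sum_negf)
  qed
  finally have form: "x \<bullet> (sym_seifert m q *\<^sub>v x) =
    ?e * (2 * (\<Sum>r<?N. f r * f r) - 2 * (\<Sum>r<?N. f r * f (r + m)))" .
  obtain t where "t < ?N" "x $ t \<noteq> 0"
    using x by (metis carrier_vecD eq_vecI index_zero_vec)
  then have "0 < 2 * (\<Sum>r<?N. f r * f r) - 2 * (\<Sum>r<?N. f r * f (r + m))"
    by (intro shift_form_positive[OF m, of _ _ t]) (auto simp: f_def)
  then show ?thesis
    unfolding form by simp
qed

end

section \<open>Counting loops by parity, and the signature\<close>

text \<open>Each of the \<open>l\<close> periods contributes an alternating sum of \<open>m\<close>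
  signs starting with -1, which is 0 for even \<open>m\<close> and -1 for odd
  \<open>m\<close>.\<close>

lemma card_parity_difference:
  "int (card {r. r < m * l \<and> odd (r mod m)}) - int (card {r. r < m * l \<and> even (r mod m)}) = - int (m mod 2 * l)"
proof -
  have *: "int (card {r. r < n \<and> odd (g r)}) - int (card {r. r < n \<and> even (g r)}) = (\<Sum>r<n. if odd (g r) then 1 else - 1)"
    for g :: "nat \<Rightarrow> nat" and n
  proof (induction n)
    case (Suc n)
    have "{r. r < Suc n \<and> R r} = (if R n then insert n {r. r < n \<and> R r} else {r. r < n \<and> R r})" for R
      by (auto simp: less_Suc_eq)
    from this[of "\<lambda>r. odd (g r)"] this[of "\<lambda>r. even (g r)"] Suc show ?case by auto
  qed simp
  have "(\<Sum>r<m * l. if odd (r mod m) then 1 else - 1) = (\<Sum>b<l. \<Sum>r\<in>{b * m..<b * m + m}. if odd (r mod m) then 1 else - 1 :: int)"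
    by (simp only: sum.nat_group mult.commute)
  also have "\<dots> = (\<Sum>b<l. \<Sum>r<m. if odd r then 1 else - 1)"
  proof (rule sum.cong[OF refl])
    fix b
    show "(\<Sum>r\<in>{b * m..<b * m + m}. if odd (r mod m) then 1 else - 1 :: int) = (\<Sum>r<m. if odd r then 1 else - 1)"
      using sum.shift_bounds_nat_ivl[of "\<lambda>r. if odd (r mod m) then 1 else - 1 :: int" 0 "b * m" m]
      by (simp add: lessThan_atLeast0 add.commute)
  qed
  also have "(\<Sum>r<m. if odd r then 1 else - 1 :: int) = - int (m mod 2)"
    by (induction m) (auto simp: mod2_eq_if)
  finally show ?thesis
    unfolding * by simp
qed

theorem signature_weaving:
  assumes m: "m > 0"
  shows "signature (weaving (Suc m) q) = - int (m mod 2 * (q - 1))"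
proof -
  let ?N = "m * (q - 1)"
  \<comment> \<open>The loops of even generators, which span the positive definite part.\<close>
  let ?C = "{r. r < ?N \<and> odd (r mod m)}"
  have "signature (weaving (Suc m) q) = matrix_signature (sym_seifert m q)"
    by (simp add: signature_def sym_seifert_def)
  also have "\<dots> = int (card ?C) - int (card ({..<?N} - ?C))"
  proof (rule matrix_signature_definite_split[OF sym_seifert_carrier[OF m] transpose_sym_seifert[OF m]])
    fix x :: "real vec"
    assume x: "x \<in> carrier_vec ?N" "x \<noteq> 0\<^sub>v ?N"
    show "0 < x \<bullet> (sym_seifert m q *\<^sub>v x)" if "\<And>i. i < ?N \<Longrightarrow> i \<notin> ?C \<Longrightarrow> x $ i = 0"
      using sym_seifert_form[OF m x, of False] that by simp
    show "x \<bullet> (sym_seifert m q *\<^sub>v x) < 0" if "\<And>i. i < ?N \<Longrightarrow> i \<in> ?C \<Longrightarrow> x $ i = 0"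
      using sym_seifert_form[OF m x, of True] that by simp
  qed auto
  also have "{..<?N} - ?C = {r. r < ?N \<and> even (r mod m)}"
    by auto
  finally show ?thesis
    by (simp only: card_parity_difference)
qed

theorem proposition2p4:
  fixes k n :: nat
  assumes "k \<ge> 1" and "n \<ge> 1"
  shows "(gcd (2 * k + 1) n = 1 \<longrightarrow> signature (weaving (2 * k + 1) n) = 0) \<and>
         (gcd (2 * k) n = 1 \<longrightarrow> signature (weaving (2 * k) n) = - int n + 1)"
proof -
  have "signature (weaving (2 * k + 1) n) = 0"
    using signature_weaving[of "2 * k" n] assms(1) by simp
  moreover have "signature (weaving (2 * k) n) = - int n + 1"
  proof -
    \<comment> \<open>This makes the number of strands \<open>Suc (2 * l + 1)\<close>, with an odd
      number of generators.\<close>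
    obtain l where l: "k = Suc l"
      using assms(1) by (cases k) auto
    have "(2 * l + 1) mod 2 = 1" by presburger
    then show ?thesis
      using signature_weaving[of "2 * l + 1" n] assms(2) unfolding l by (simp add: of_nat_diff)
  qed
  ultimately show ?thesis by blast
qed

end
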